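(* Let $n\equiv2\pmod4$, $n\ge6$. The set $N=I+\mathfrak{a}=\{I+X : X\in\mathfrak{a}\}$ is a normal subgroup of $\mathrm{Sol}_{A_n^2}$ with $\mathrm{Lie}(N)\simeq\mathfrak{a}$, where $I$ is the diagonal matrix with $1$ and $-1$ alternately on the diagonal.
   Context: $A_n$ is the $n\times n$ complex matrix with $(A_n)_{i,i+1}=1$ for $1\le i\le n-1$ and zeros elsewhere; $A_n^2$ is its square. $\mathrm{Sol}_{A_n^2}=\{X\in M_n(\mathbb{C}) : X^tA_n^2X=A_n^2\}$, which is a group under matrix multiplication for $n\ge4$. $\mathrm{Lie}(N)$ denotes the Lie algebra of $N$. Put $m=n/2$ (odd) and view $n\times n$ matrices as $m\times m$ matrices of $2\times2$ blocks $X_{(p,q)}$, $1\le p,q\le m$. $\mathfrak{a}$ is the set of all $X\in M_n(\mathbb{C})$ for which there exist $x_1,\dots,x_{(n-2)/4}\in M_2(\mathbb{C})$ such that: $X_{(p,q)}=x_{(q-p+1)/2}$ for $p$ odd, $q$ even, $p<q$; $X_{(p,q)}=-x_{(p-q+1)/2}^t$ for $p$ odd, $q$ even, $p>q$; and $X_{(p,q)}=0$ otherwise. It is an abelian Lie ideal of the Lie algebra $\mathrm{sol}_{A_n^2}=\{X\in M_n(\mathbb{C}) : X^tA_n^2+A_n^2X=0\}$ (with bracket $XY-YX$).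
   Formalization: I is taken to be the identity matrix instead of the diagonal matrix with alternating 1 and -1: elements of 𝔞 have zero diagonal, so with the alternating matrix I+𝔞 never contains the identity and is not a subgroup. *)

theory Defs
  imports
    Complex_Main
    "HOL-Algebra.Coset"
    "Jordan_Normal_Form.Matrix"
begin

text \<open>Library matrices are indexed from 0; the superdiagonal is unaffected by this shift.\<close>

definition A_mat :: "nat \<Rightarrow> complex mat" where
  "A_mat n = mat n n (\<lambda>(i, j). if j = Suc i then 1 else 0)"

definition Sol_carrier :: "nat \<Rightarrow> complex mat \<Rightarrow> complex mat set" where
  "Sol_carrier n B = {X \<in> carrier_mat n n. transpose_mat X * B * X = B}"

definition Sol :: "nat \<Rightarrow> complex mat \<Rightarrow> complex mat monoid" where
  "Sol n B = \<lparr>carrier = Sol_carrier n B, monoid.mult = (*), one = 1\<^sub>m n\<rparr>"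

text \<open>The \<open>2 \<times> 2\<close> block in position \<open>(p, q)\<close>, where block positions count from 1.\<close>

definition block :: "complex mat \<Rightarrow> nat \<Rightarrow> nat \<Rightarrow> complex mat" where
  "block X p q = mat 2 2 (\<lambda>(i, j). X $$ (2 * (p - 1) + i, 2 * (q - 1) + j))"

text \<open>In both branches that use \<open>x\<close>, the natural-number subtraction does not truncate and
  the division by 2 is exact.\<close>

definition ideal_a :: "nat \<Rightarrow> complex mat set" where
  "ideal_a n = {X \<in> carrier_mat n n.
     \<exists>x :: nat \<Rightarrow> complex mat.
       (\<forall>k \<in> {1..(n - 2) div 4}. x k \<in> carrier_mat 2 2) \<and>
       (\<forall>p \<in> {1..n div 2}. \<forall>q \<in> {1..n div 2}.
          block X p q =
            (if odd p \<and> even q \<and> p < q then x ((q - p + 1) div 2)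
             else if odd p \<and> even q \<and> p > q then - transpose_mat (x ((p - q + 1) div 2))
             else 0\<^sub>m 2 2))}"

definition shifted_a :: "nat \<Rightarrow> complex mat \<Rightarrow> complex mat set" where
  "shifted_a n D = {D + X | X. X \<in> ideal_a n}"

text \<open>The exponential series is summed entrywise; it converges absolutely for every
  \<open>X \<in> carrier_mat n n\<close>.\<close>

definition mat_exp :: "nat \<Rightarrow> complex mat \<Rightarrow> complex mat" where
  "mat_exp n X = mat n n (\<lambda>(i, j). \<Sum>k. (X ^\<^sub>m k) $$ (i, j) / fact k)"

text \<open>The Lie algebra of a matrix group, as the set of generators of its real
  one-parameter subgroups.\<close>

definition Lie_algebra_of :: "nat \<Rightarrow> complex mat set \<Rightarrow> complex mat set" where
  "Lie_algebra_of n H =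
     {X \<in> carrier_mat n n. \<forall>t :: real. mat_exp n (complex_of_real t \<cdot>\<^sub>m X) \<in> H}"

definition lie_bracket :: "complex mat \<Rightarrow> complex mat \<Rightarrow> complex mat" where
  "lie_bracket X Y = X * Y - Y * X"

definition matrix_lie_algebra :: "nat \<Rightarrow> complex mat set \<Rightarrow> bool" where
  "matrix_lie_algebra n L \<longleftrightarrow>
     L \<subseteq> carrier_mat n n \<and> 0\<^sub>m n n \<in> L \<and>
     (\<forall>X \<in> L. \<forall>Y \<in> L. X + Y \<in> L) \<and>
     (\<forall>c. \<forall>X \<in> L. c \<cdot>\<^sub>m X \<in> L) \<and>
     (\<forall>X \<in> L. \<forall>Y \<in> L. lie_bracket X Y \<in> L)"

definition lie_isomorphic :: "nat \<Rightarrow> complex mat set \<Rightarrow> complex mat set \<Rightarrow> bool" where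
  "lie_isomorphic n L M \<longleftrightarrow>
     matrix_lie_algebra n L \<and> matrix_lie_algebra n M \<and>
     (\<exists>\<phi>. bij_betw \<phi> L M \<and>
        (\<forall>X \<in> L. \<forall>Y \<in> L. \<phi> (X + Y) = \<phi> X + \<phi> Y) \<and>
        (\<forall>c. \<forall>X \<in> L. \<phi> (c \<cdot>\<^sub>m X) = c \<cdot>\<^sub>m \<phi> X) \<and>
        (\<forall>X \<in> L. \<forall>Y \<in> L. \<phi> (lie_bracket X Y) = lie_bracket (\<phi> X) (\<phi> Y)))"

text \<open>The source describes \<open>N\<close> as \<open>I + \<aa>\<close> with \<open>I\<close> the diagonal matrix whose entries are
  alternately \<open>1\<close> and \<open>-1\<close>. That set is not a subgroup: elements of \<open>\<aa>\<close> have zero diagonal,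
  so it does not contain the identity matrix. In fact \<open>D + \<aa>\<close> can contain the identity only
  if \<open>D + \<aa>\<close> is the set \<open>1 + \<aa>\<close>, so this is the only translate of \<open>\<aa>\<close> that can be a
  subgroup, and \<open>I\<close> has to be read as the identity matrix.\<close>

definition alternating_diag :: "nat \<Rightarrow> complex mat" where
  "alternating_diag n = mat n n (\<lambda>(i, j). if i = j then (- 1) ^ i else 0)"

lemma ideal_a_diag_zero:
  assumes X: "X \<in> ideal_a n" and n: "even n" and i: "i < n"
  shows "X $$ (i, i) = 0"
proof -
  define p where "p = i div 2 + 1"
  have p: "p \<in> {1..n div 2}"
    using i n unfolding p_def by (auto elim!: evenE)
  have "block X p p = 0\<^sub>m 2 2"
    using X p unfolding ideal_a_def by auto
  moreover have "block X p p $$ (i mod 2, i mod 2) = X $$ (i, i)"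
    by (simp add: block_def p_def)
  ultimately show ?thesis
    by simp
qed

lemma alternating_shift_not_subgroup:
  assumes n: "even n" "n \<ge> 2"
  shows "\<not> subgroup (shifted_a n (alternating_diag n)) (Sol n B)"
proof
  assume "subgroup (shifted_a n (alternating_diag n)) (Sol n B)"
  then have "1\<^sub>m n \<in> shifted_a n (alternating_diag n)"
    using subgroup.one_closed by (fastforce simp: Sol_def)
  then obtain X where X: "X \<in> ideal_a n" and eq: "1\<^sub>m n = alternating_diag n + X"
    by (auto simp: shifted_a_def)
  have "X \<in> carrier_mat n n"
    using X by (simp add: ideal_a_def)
  then have "(1\<^sub>m n :: complex mat) $$ (1, 1) = alternating_diag n $$ (1, 1) + X $$ (1, 1)"
    using n eq by auto
  then show False
    using n ideal_a_diag_zero[OF X n(1), of 1] by (simp add: alternating_diag_def)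
qed

end

theory Submission
  imports Defs "Jordan_Normal_Form.Determinant"
begin

text \<open>Write \<open>B = A\<^sup>2\<close>. Inside the Lie algebra \<open>{X. X\<^sup>t B + B X = 0}\<close>, the block-Toeplitz conditions
  defining \<open>\<aa>\<close> amount to the single requirement that \<open>X\<close> vanishes on the span \<open>V\<close> of the
  odd-numbered coordinate blocks and maps into \<open>V\<close>. Hence products of two elements of \<open>\<aa>\<close> vanish,
  so \<open>1 + \<aa>\<close> is a group of isometries of \<open>B\<close> and \<open>exp (t X) = 1 + t X\<close> on \<open>\<aa>\<close>; conversely an
  element of the Lie algebra is the derivative at 0 of its one-parameter group and \<open>\<aa>\<close> is closed
  under limits. Normality holds because every isometry of \<open>B\<close> preserves \<open>V\<close>.\<close>

section \<open>The square of the nilpotent Jordan block and products with it in coordinates\<close>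

definition shift2 :: "nat \<Rightarrow> complex mat" where
  "shift2 n = mat n n (\<lambda>(i, j). if j = i + 2 then 1 else 0)"

lemma shift2_carrier [simp]: "shift2 n \<in> carrier_mat n n"
  by (simp add: shift2_def)

lemma shift2_dim [simp]: "dim_row (shift2 n) = n" "dim_col (shift2 n) = n"
  by (simp_all add: shift2_def)

lemma A_mat_square: "A_mat n ^\<^sub>m 2 = shift2 n"
proof (rule eq_matI)
  fix i j assume "i < dim_row (shift2 n)" "j < dim_col (shift2 n)"
  then have ij: "i < n" "j < n" by simp_all
  have A: "A_mat n \<in> carrier_mat n n" by (simp add: A_mat_def)
  have "(A_mat n ^\<^sub>m 2) $$ (i, j) = (A_mat n * A_mat n) $$ (i, j)"
    using A by (simp add: numeral_2_eq_2)
  also have "\<dots> = (\<Sum>k = 0..<n. (if k = Suc i then 1 else 0) * (if j = Suc k then 1 else 0))"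
    using ij by (simp add: A_mat_def scalar_prod_def)
  also have "\<dots> = (\<Sum>k = 0..<n. (if k = Suc i then (if j = i + 2 then 1 else 0) else 0))"
    by (rule sum.cong) auto
  also have "\<dots> = shift2 n $$ (i, j)"
    using ij by (simp add: shift2_def)
  finally show "(A_mat n ^\<^sub>m 2) $$ (i, j) = shift2 n $$ (i, j)" .
qed (simp_all add: A_mat_def pow_mat_dim)

lemma shift2_mult_index:
  assumes "X \<in> carrier_mat n n" "i < n" "j < n"
  shows "(shift2 n * X) $$ (i, j) = (if i + 2 < n then X $$ (i + 2, j) else 0)"
proof -
  have "(shift2 n * X) $$ (i, j) = (\<Sum>k = 0..<n. (if k = i + 2 then 1 else 0) * X $$ (k, j))"
    using assms by (simp add: shift2_def scalar_prod_def)
  also have "\<dots> = (\<Sum>k = 0..<n. if k = i + 2 then X $$ (i + 2, j) else 0)"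
    by (rule sum.cong) auto
  finally show ?thesis using assms by auto
qed

lemma transpose_shift2_mult_index:
  assumes "X \<in> carrier_mat n n" "i < n" "j < n"
  shows "(transpose_mat (shift2 n) * X) $$ (i, j) = (if 2 \<le> i then X $$ (i - 2, j) else 0)"
proof -
  have "(transpose_mat (shift2 n) * X) $$ (i, j) = (\<Sum>k = 0..<n. (if i = k + 2 then 1 else 0) * X $$ (k, j))"
    using assms by (simp add: shift2_def scalar_prod_def)
  \<comment> \<open>For \<open>i < 2\<close> the truncated \<open>i - 2\<close> is 0 and would
    select a spurious term; the inner conditional makes that term 0.\<close>
  also have "\<dots> = (\<Sum>k = 0..<n. if k = i - 2 then (if 2 \<le> i then X $$ (i - 2, j) else 0) else 0)"
    by (rule sum.cong) auto
  finally show ?thesis using assms by auto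
qed

lemma mult_shift2_index:
  assumes "X \<in> carrier_mat n n" "i < n" "j < n"
  shows "(X * shift2 n) $$ (i, j) = (if 2 \<le> j then X $$ (i, j - 2) else 0)"
proof -
  have "(X * shift2 n) $$ (i, j) = (\<Sum>k = 0..<n. X $$ (i, k) * (if j = k + 2 then 1 else 0))"
    using assms by (simp add: shift2_def scalar_prod_def)
  also have "\<dots> = (\<Sum>k = 0..<n. if k = j - 2 then (if 2 \<le> j then X $$ (i, j - 2) else 0) else 0)"
    by (rule sum.cong) auto
  finally show ?thesis using assms by auto
qed

lemma mult_transpose_shift2_index:
  assumes "X \<in> carrier_mat n n" "i < n" "j < n"
  shows "(X * transpose_mat (shift2 n)) $$ (i, j) = (if j + 2 < n then X $$ (i, j + 2) else 0)"
proof -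
  have "(X * transpose_mat (shift2 n)) $$ (i, j) = (\<Sum>k = 0..<n. X $$ (i, k) * (if k = j + 2 then 1 else 0))"
    using assms by (simp add: shift2_def scalar_prod_def)
  also have "\<dots> = (\<Sum>k = 0..<n. if k = j + 2 then X $$ (i, j + 2) else 0)"
    by (rule sum.cong) auto
  finally show ?thesis using assms by auto
qed

lemma mat_mult_entry:
  fixes X Y :: "'a :: semiring_0 mat"
  assumes "X \<in> carrier_mat n n" "Y \<in> carrier_mat n n" "i < n" "j < n"
  shows "(X * Y) $$ (i, j) = (\<Sum>k = 0..<n. X $$ (i, k) * Y $$ (k, j))"
  using assms by (simp add: scalar_prod_def)

subsection \<open>The ideal\<close>

lemma ideal_a_carrier: "X \<in> ideal_a n \<Longrightarrow> X \<in> carrier_mat n n"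
  by (simp add: ideal_a_def)

lemma block_index:
  "X $$ (i, j) = block X (i div 2 + 1) (j div 2 + 1) $$ (i mod 2, j mod 2)"
  by (simp add: block_def)

text \<open>Counting from 0, odd block rows are the row indices with residue below 2 mod 4, and even
  block columns are the column indices with residue at least 2; this is the support condition.
  Transposing a block position and moving it one block down the diagonal leads from a parameter to
  its negative transpose, which gives the sign rule. Applied twice, the rule yields period 4 along
  diagonals, so the first block row determines everything.\<close>

lemma ideal_a_entries:
  assumes n: "n mod 4 = 2"
  shows "X \<in> ideal_a n \<longleftrightarrow> X \<in> carrier_mat n n \<and>
    (\<forall>i<n. \<forall>j<n. 2 \<le> i mod 4 \<or> j mod 4 < 2 \<longrightarrow> X $$ (i, j) = 0) \<and>
    (\<forall>i j. i + 2 < n \<longrightarrow> j + 2 < n \<longrightarrow> X $$ (i + 2, j + 2) = - X $$ (j, i))"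
    (is "_ \<longleftrightarrow> _ \<and> ?supp \<and> ?skew")
proof -
  obtain m where m: "n = 4 * m + 2"
    using n by (metis div_mult_mod_eq mult.commute)
  have half: "n div 2 = 2 * m + 1" "(n - 2) div 4 = m"
    by (simp_all add: m)
  show ?thesis
  proof (intro iffI conjI)
    assume X: "X \<in> ideal_a n"
    then show "X \<in> carrier_mat n n" by (simp add: ideal_a_def)
    obtain x :: "nat \<Rightarrow> complex mat" where x: "\<forall>k \<in> {1..(n - 2) div 4}. x k \<in> carrier_mat 2 2"
      and "\<forall>p \<in> {1..n div 2}. \<forall>q \<in> {1..n div 2}. block X p q =
              (if odd p \<and> even q \<and> p < q then x ((q - p + 1) div 2)
               else if odd p \<and> even q \<and> p > q then - transpose_mat (x ((p - q + 1) div 2))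
               else 0\<^sub>m 2 2)"
      using X unfolding ideal_a_def mem_Collect_eq by (elim conjE exE)
    note blk = this(2)[rule_format]
    show supp: ?supp
    proof (intro allI impI)
      fix i j assume ij: "i < n" "j < n" "2 \<le> i mod 4 \<or> j mod 4 < 2"
      have "i div 2 + 1 \<in> {1..n div 2}" "j div 2 + 1 \<in> {1..n div 2}"
        using ij unfolding half by (auto simp: m)
      moreover have "\<not> (odd (i div 2 + 1) \<and> even (j div 2 + 1))"
        using ij(3) by presburger
      ultimately show "X $$ (i, j) = 0"
        by (subst block_index, subst blk) auto
    qed
    show ?skew
    proof (intro allI impI)
      fix i j assume ij: "i + 2 < n" "j + 2 < n"
      show "X $$ (i + 2, j + 2) = - X $$ (j, i)"
      \<comment> \<open>Adding 2 exchanges the two residue classes mod 4, so \<open>(j, i)\<close>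
        and \<open>(i + 2, j + 2)\<close> lie in the support together or not at all.\<close>
      proof (cases "2 \<le> i mod 4 \<and> j mod 4 < 2")
        case False
        then have "2 \<le> (i + 2) mod 4 \<or> (j + 2) mod 4 < 2" by presburger
        then show ?thesis using supp ij False by auto
      next
        case True
        define P a Q b where "P = j div 4" and "a = j mod 2" and "Q = i div 4" and "b = i mod 2"
        have j: "j = 4 * P + a" and i: "i = 4 * Q + 2 + b"
          using True unfolding P_def a_def Q_def b_def by presburger+
        have ab: "a < 2" "b < 2" by (simp_all add: a_def b_def)
        have le: "P + 1 \<le> m" "Q + 1 \<le> m" using ij i j m by linarith+
        have e1: "X $$ (j, i) = block X (2 * P + 1) (2 * Q + 2) $$ (a, b)"
          using ab by (simp add: block_def i j algebra_simps)
        have e2: "X $$ (i + 2, j + 2) = block X (2 * Q + 3) (2 * P + 2) $$ (b, a)"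
          using ab by (simp add: block_def i j algebra_simps)
        show ?thesis
        \<comment> \<open>The two blocks lie on opposite sides of the block diagonal and carry the
          same parameter, of index \<open>Q - P + 1\<close> or \<open>P - Q\<close>.\<close>
        proof (cases "P \<le> Q")
          case 1: True
          have k: "Q - P + 1 \<in> {1..(n - 2) div 4}"
            using 1 le unfolding half by simp
          have "(2 * Q + 2 - (2 * P + 1) + 1) div 2 = Q - P + 1"
            "(2 * Q + 3 - (2 * P + 2) + 1) div 2 = Q - P + 1"
            using 1 by (simp_all add: Suc_diff_le)
          then have "block X (2 * P + 1) (2 * Q + 2) = x (Q - P + 1)"
            "block X (2 * Q + 3) (2 * P + 2) = - transpose_mat (x (Q - P + 1))"
            using blk[of "2 * P + 1" "2 * Q + 2"] blk[of "2 * Q + 3" "2 * P + 2"] 1 le half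
            by simp_all
          then show ?thesis
            using bspec[OF x k] ab unfolding e1 e2 by simp
        next
          case 2: False
          have k: "P - Q \<in> {1..(n - 2) div 4}"
            using 2 le unfolding half by auto
          have "(2 * P + 1 - (2 * Q + 2) + 1) div 2 = P - Q"
            "(2 * P + 2 - (2 * Q + 3) + 1) div 2 = P - Q"
            using 2 by simp_all
          then have "block X (2 * P + 1) (2 * Q + 2) = - transpose_mat (x (P - Q))"
            "block X (2 * Q + 3) (2 * P + 2) = x (P - Q)"
            using blk[of "2 * P + 1" "2 * Q + 2"] blk[of "2 * Q + 3" "2 * P + 2"] 2 le half
            by simp_all
          then show ?thesis
            using bspec[OF x k] ab unfolding e1 e2 by simp
        qed
      qed
    qed
  next
    assume *: "X \<in> carrier_mat n n \<and> ?supp \<and> ?skew"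
    then have car: "X \<in> carrier_mat n n"
      and supp: "\<And>i j. i < n \<Longrightarrow> j < n \<Longrightarrow> 2 \<le> i mod 4 \<or> j mod 4 < 2 \<Longrightarrow> X $$ (i, j) = 0"
      and skew: "\<And>i j. i + 2 < n \<Longrightarrow> j + 2 < n \<Longrightarrow> X $$ (i + 2, j + 2) = - X $$ (j, i)"
      by blast+
    have step: "X $$ (i + 4, j + 4) = X $$ (i, j)" if "i + 4 < n" "j + 4 < n" for i j
      using skew[of "i + 2" "j + 2"] skew[of j i] that by (simp add: numeral_eq_Suc)
    have toeplitz: "X $$ (i + 4 * k, j + 4 * k) = X $$ (i, j)"
      if "i + 4 * k < n" "j + 4 * k < n" for i j k
      using that
    proof (induction k)
      case (Suc k)
      then show ?case using step[of "i + 4 * k" "j + 4 * k"] by (simp add: ac_simps)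
    qed simp
    \<comment> \<open>The parameters are read off the first block row.\<close>
    define x where "x k = block X 1 (2 * k)" for k
    have blk: "block X p q = (if odd p \<and> even q \<and> p < q then x ((q - p + 1) div 2)
               else if odd p \<and> even q \<and> p > q then - transpose_mat (x ((p - q + 1) div 2))
               else 0\<^sub>m 2 2)" (is "_ = ?R")
      if pq: "p \<in> {1..n div 2}" "q \<in> {1..n div 2}" for p q
    proof (rule eq_matI)
      fix a b assume "a < dim_row ?R" "b < dim_col ?R"
      then have ab: "a < 2" "b < 2"
        by (auto simp: x_def block_def split: if_splits)
      have l: "2 * (p - 1) + a < n" "2 * (q - 1) + b < n"
        using pq ab unfolding half by (auto simp: m)
      have lhs: "block X p q $$ (a, b) = X $$ (2 * (p - 1) + a, 2 * (q - 1) + b)"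
        using ab by (simp add: block_def)
      show "block X p q $$ (a, b) = ?R $$ (a, b)"
      proof (cases "odd p \<and> even q")
        case False
        have "2 \<le> (2 * (p - 1) + a) mod 4 \<or> (2 * (q - 1) + b) mod 4 < 2"
        proof (cases "odd p")
          case True
          with False obtain Q where "q = 2 * Q + 1" by (auto elim: oddE)
          then show ?thesis using ab by simp
        next
          case False
          then have "p = 2 * (p div 2 - 1) + 2" using pq by (auto elim!: evenE)
          then obtain P where "p = 2 * P + 2" ..
          then have "2 * (p - 1) + a = a + 2 + 4 * P" by simp
          then have "(2 * (p - 1) + a) mod 4 = (a + 2) mod 4" by (simp only: mod_mult_self2)
          then have "2 \<le> (2 * (p - 1) + a) mod 4" using ab by simp
          then show ?thesis ..
        qed
        then show ?thesis using False ab supp[OF l] lhs by auto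
      next
        case True
        obtain P where p: "p = 2 * P + 1" using True by (auto elim: oddE)
        have "q = 2 * (q div 2 - 1) + 2" using True pq by (auto elim!: evenE)
        then obtain Q where q: "q = 2 * Q + 2" ..
        have l': "4 * P + a < n" "4 * Q + 2 + b < n" using l p q by simp_all
        have lhs': "block X p q $$ (a, b) = X $$ (4 * P + a, 4 * Q + 2 + b)"
          using ab unfolding p q by (simp add: block_def algebra_simps)
        have x_entry: "x k $$ (c, d) = X $$ (c, 4 * k - 2 + d)" if "c < 2" "d < 2" for k c d
        proof -
          have "2 * (2 * k - Suc 0) = 4 * k - 2" by simp
          then show ?thesis using that by (simp add: x_def block_def)
        qed
        show ?thesis
        proof (cases "P \<le> Q")
          case le: True
          have "X $$ (4 * P + a, 4 * Q + 2 + b) = X $$ (a + 4 * P, 4 * (Q - P) + 2 + b + 4 * P)"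
            using le by (intro arg_cong[where f = "\<lambda>z. X $$ z"]) auto
          also have "\<dots> = X $$ (a, 4 * (Q - P) + 2 + b)"
            using l' le by (intro toeplitz) auto
          also have "\<dots> = x (Q - P + 1) $$ (a, b)"
            using ab by (simp add: x_entry)
          also have "Q - P + 1 = (q - p + 1) div 2"
            using le p q by (simp add: Suc_diff_le)
          finally show ?thesis using True le p q unfolding lhs' by simp
        next
          case gt: False
          \<comment> \<open>Below the block diagonal one sign step first crosses to the other side,
            then period 4 slides the entry to the first block row. Since \<open>P > Q\<close>, the
            subtraction in \<open>4 * (P - Q) - 2\<close> is exact.\<close>
          have "X $$ (4 * P + a, 4 * Q + 2 + b)
              = X $$ (4 * (P - Q) - 2 + a + 4 * Q + 2, b + 4 * Q + 2)"
            using gt by (intro arg_cong[where f = "\<lambda>z. X $$ z"]) auto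
          also have "\<dots> = - X $$ (b + 4 * Q, 4 * (P - Q) - 2 + a + 4 * Q)"
            using l' gt by (intro skew) auto
          also have "\<dots> = - X $$ (b, 4 * (P - Q) - 2 + a)"
            using l' gt by (subst toeplitz) auto
          also have "\<dots> = - (x (P - Q) $$ (b, a))"
            using ab by (simp add: x_entry)
          also have "\<dots> = (- transpose_mat (x (P - Q))) $$ (a, b)"
            using ab by (simp add: x_def block_def)
          also have "P - Q = (p - q + 1) div 2"
            using gt p q by simp
          finally show ?thesis using True gt p q unfolding lhs' by simp
        qed
      qed
    qed (auto simp: block_def x_def)
    have "x k \<in> carrier_mat 2 2" for k by (simp add: x_def block_def)
    then show "X \<in> ideal_a n"
      using car blk unfolding ideal_a_def mem_Collect_eq
      by (intro conjI exI[of _ x] ballI)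
  qed
qed


text \<open>At position \<open>(i, j + 2)\<close> with \<open>i + 2 < n\<close>, the matrix equation
  is the sign rule for \<open>(i, j)\<close>; where one of its terms falls off the edge, the support
  condition kills the other. This form of the sign rule is the one that can be transported by
  conjugation.\<close>

lemma ideal_a_lie:
  assumes n: "n mod 4 = 2"
  shows "X \<in> ideal_a n \<longleftrightarrow> X \<in> carrier_mat n n \<and>
    (\<forall>i<n. \<forall>j<n. 2 \<le> i mod 4 \<or> j mod 4 < 2 \<longrightarrow> X $$ (i, j) = 0) \<and>
    transpose_mat X * shift2 n + shift2 n * X = 0\<^sub>m n n"
    (is "_ \<longleftrightarrow> _ \<and> ?supp \<and> ?lie")
proof -
  obtain m where m: "n = 4 * m + 2"
    using n by (metis div_mult_mod_eq mult.commute)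
  have entry: "(transpose_mat X * shift2 n + shift2 n * X) $$ (i, j) =
      (if 2 \<le> j then X $$ (j - 2, i) else 0) + (if i + 2 < n then X $$ (i + 2, j) else 0)"
    if "X \<in> carrier_mat n n" "i < n" "j < n" for i j
    using that mult_shift2_index[of "transpose_mat X" n i j] shift2_mult_index[of X n i j]
    by (simp del: index_mult_mat(1))
  have "?lie \<longleftrightarrow> (\<forall>i j. i + 2 < n \<longrightarrow> j + 2 < n \<longrightarrow> X $$ (i + 2, j + 2) = - X $$ (j, i))"
    if X: "X \<in> carrier_mat n n" and supp: ?supp
  proof (intro iffI allI impI)
    fix i j assume ?lie and ij: "i + 2 < n" "j + 2 < n"
    from arg_cong[OF this(1), of "\<lambda>M. M $$ (i, j + 2)"]
    have "X $$ (j, i) + X $$ (i + 2, j + 2) = 0"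
      using entry[OF X, of i "j + 2"] ij by simp
    then show "X $$ (i + 2, j + 2) = - X $$ (j, i)"
      by (simp add: eq_neg_iff_add_eq_0 add.commute)
  next
    assume skew: "\<forall>i j. i + 2 < n \<longrightarrow> j + 2 < n \<longrightarrow> X $$ (i + 2, j + 2) = - X $$ (j, i)"
    show ?lie
    proof (rule eq_matI)
      fix i j assume "i < dim_row (0\<^sub>m n n)" "j < dim_col (0\<^sub>m n n)"
      then have ij: "i < n" "j < n" by simp_all
      consider "2 \<le> j" "i + 2 < n" | "j < 2" "i + 2 < n" | "n \<le> i + 2" by linarith
      then have "(if 2 \<le> j then X $$ (j - 2, i) else 0)
          + (if i + 2 < n then X $$ (i + 2, j) else 0) = 0"
      proof cases
        case 1
        then show ?thesis using skew[rule_format, of i "j - 2"] ij le_add_diff_inverse2[of 2 j] by auto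
      next
        case 2
        then have "X $$ (i + 2, j) = 0" using supp ij by simp
        then show ?thesis using 2 by simp
      next
        \<comment> \<open>Because \<open>n mod 4 = 2\<close>, the last two indices have residue 0
          and 1, so their columns are zero.\<close>
        case 3
        then have "i = 4 * m \<or> i = 4 * m + 1" using ij m by linarith
        then have "i mod 4 < 2" by auto
        then have "X $$ (j - 2, i) = 0" using supp ij by simp
        then show ?thesis using 3 by simp
      qed
      then show "(transpose_mat X * shift2 n + shift2 n * X) $$ (i, j) = 0\<^sub>m n n $$ (i, j)"
        using entry[OF X ij] ij by simp
    qed (use X in simp_all)
  qed
  then show ?thesis
    unfolding ideal_a_entries[OF n] by blast
qed

text \<open>A nonzero term would need an inner index with residue at least 2 mod 4 as a column of
  \<open>X\<close>, and below 2 as a row of \<open>Y\<close>.\<close>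

lemma ideal_a_mult_eq_0:
  assumes n: "n mod 4 = 2" and X: "X \<in> ideal_a n" and Y: "Y \<in> ideal_a n"
  shows "X * Y = 0\<^sub>m n n"
proof (rule eq_matI)
  fix i j assume "i < dim_row (0\<^sub>m n n)" "j < dim_col (0\<^sub>m n n)"
  then have ij: "i < n" "j < n" by simp_all
  have "X $$ (i, k) * Y $$ (k, j) = 0" if "k < n" for k
    using X Y ij that unfolding ideal_a_entries[OF n] by (cases "k mod 4 < 2") auto
  moreover have "X \<in> carrier_mat n n" "Y \<in> carrier_mat n n"
    using X Y by (simp_all add: ideal_a_def)
  ultimately show "(X * Y) $$ (i, j) = 0\<^sub>m n n $$ (i, j)"
    using ij by (auto simp: scalar_prod_def intro!: sum.neutral)
qed (use X Y in \<open>auto dest: ideal_a_carrier\<close>)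

text \<open>This is the quadratic term of the isometry condition for \<open>1\<^sub>m n + X\<close>.
  Multiplying the Lie algebra equation by \<open>X\<close> on the right leaves only this term, as
  \<open>X * X\<close> vanishes.\<close>

lemma ideal_a_sandwich_eq_0:
  assumes n: "n mod 4 = 2" and X: "X \<in> ideal_a n"
  shows "transpose_mat X * shift2 n * X = 0\<^sub>m n n"
proof -
  have car: "X \<in> carrier_mat n n" using X by (simp add: ideal_a_def)
  have "transpose_mat X * shift2 n + shift2 n * X = 0\<^sub>m n n"
    using X unfolding ideal_a_lie[OF n] by blast
  then have "(transpose_mat X * shift2 n + shift2 n * X) * X = 0\<^sub>m n n"
    using car by simp
  then have "transpose_mat X * shift2 n * X + shift2 n * (X * X) = 0\<^sub>m n n"
    using car by (subst (asm) add_mult_distrib_mat[of _ n n])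
      (auto simp: assoc_mult_mat[of _ n n _ n _ n])
  then show ?thesis
    using car mult_carrier_mat[of "transpose_mat X * shift2 n" n n X n]
    by (simp add: ideal_a_mult_eq_0[OF n X X])
qed

section \<open>Linear structure and closedness of the ideal\<close>

lemma ideal_a_add:
  assumes n: "n mod 4 = 2" and X: "X \<in> ideal_a n" and Y: "Y \<in> ideal_a n"
  shows "X + Y \<in> ideal_a n"
proof -
  have "Y \<in> carrier_mat n n" using Y by (simp add: ideal_a_def)
  then have "(X + Y) $$ (i, j) = X $$ (i, j) + Y $$ (i, j)" if "i < n" "j < n" for i j
    using that by simp
  then show ?thesis
    using X Y unfolding ideal_a_entries[OF n] by auto
qed

lemma ideal_a_smult:
  assumes n: "n mod 4 = 2" and X: "X \<in> ideal_a n"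
  shows "c \<cdot>\<^sub>m X \<in> ideal_a n"
proof -
  have "X \<in> carrier_mat n n" using X by (simp add: ideal_a_def)
  then have "(c \<cdot>\<^sub>m X) $$ (i, j) = c * X $$ (i, j)" if "i < n" "j < n" for i j
    using that by simp
  then show ?thesis
    using X unfolding ideal_a_entries[OF n] by auto
qed

lemma ideal_a_zero:
  assumes n: "n mod 4 = 2"
  shows "0\<^sub>m n n \<in> ideal_a n"
  unfolding ideal_a_entries[OF n] by simp

text \<open>The conditions are linear equations between finitely many entries, hence survive limits.
  It is applied to difference quotients of the exponential.\<close>

lemma ideal_a_entrywise_limit:
  assumes n: "n mod 4 = 2" and X: "X \<in> carrier_mat n n" and Y: "\<And>k. Y k \<in> ideal_a n"
    and lim: "\<And>i j. i < n \<Longrightarrow> j < n \<Longrightarrow> (\<lambda>k. Y k $$ (i, j)) \<longlonglongrightarrow> X $$ (i, j)"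
  shows "X \<in> ideal_a n"
proof -
  have "X $$ (i, j) = 0" if "i < n" "j < n" "2 \<le> i mod 4 \<or> j mod 4 < 2" for i j
  proof -
    have "Y k $$ (i, j) = 0" for k
      using Y that unfolding ideal_a_entries[OF n] by blast
    then show ?thesis
      using lim[OF that(1,2)] by (simp add: LIMSEQ_const_iff)
  qed
  moreover have "X $$ (i + 2, j + 2) = - X $$ (j, i)" if ij: "i + 2 < n" "j + 2 < n" for i j
  proof -
    have "Y k $$ (i + 2, j + 2) = - Y k $$ (j, i)" for k
      using Y ij unfolding ideal_a_entries[OF n] by blast
    then have "(\<lambda>k. - Y k $$ (j, i)) \<longlonglongrightarrow> X $$ (i + 2, j + 2)"
      using lim[OF ij] by simp
    moreover have "(\<lambda>k. - Y k $$ (j, i)) \<longlonglongrightarrow> - X $$ (j, i)"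
      using ij by (intro tendsto_minus lim) auto
    ultimately show ?thesis by (rule LIMSEQ_unique)
  qed
  ultimately show ?thesis
    using X unfolding ideal_a_entries[OF n] by blast
qed

subsection \<open>The isometry group\<close>

text \<open>The form is not symmetric, so its transpose is a second form with the same isometries;
  invertibility and block triangularity both come from using the two together.\<close>

lemma Sol_carrier_transpose:
  assumes "X \<in> Sol_carrier n B" "B \<in> carrier_mat n n"
  shows "transpose_mat X * transpose_mat B * X = transpose_mat B"
proof -
  have X: "X \<in> carrier_mat n n" "transpose_mat X * B * X = B"
    using assms by (simp_all add: Sol_carrier_def)
  have "transpose_mat (transpose_mat X * B * X) = transpose_mat X * transpose_mat B * X"
    using X(1) assms(2) by (simp add: transpose_mult[of _ n n _ n] assoc_mult_mat[of _ n n _ n _ n])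
  then show ?thesis using X(2) by simp
qed

lemma Sol_carrier_mult:
  assumes X: "X \<in> Sol_carrier n B" and Y: "Y \<in> Sol_carrier n B" and B: "B \<in> carrier_mat n n"
  shows "X * Y \<in> Sol_carrier n B"
proof -
  have c: "X \<in> carrier_mat n n" "Y \<in> carrier_mat n n"
    and e: "transpose_mat X * B * X = B" "transpose_mat Y * B * Y = B"
    using X Y by (simp_all add: Sol_carrier_def)
  have "transpose_mat (X * Y) * B * (X * Y) = transpose_mat Y * (transpose_mat X * B * X) * Y"
    using c B by (simp add: transpose_mult[of _ n n _ n] assoc_mult_mat[of _ n n _ n _ n])
  then show ?thesis using c e by (simp add: Sol_carrier_def)
qed

text \<open>\<open>shift2 n\<close> is singular, so determinants of the isometry equation say
  nothing about \<open>X\<close>. Instead, a vector killed by \<open>X\<close> is killed by the form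
  and by its transpose: the first makes the coordinates from 2 on vanish, the second those below
  \<open>n - 2\<close>, and \<open>4 \<le> n\<close> leaves none.\<close>

lemma Sol_carrier_inverse:
  assumes X: "X \<in> Sol_carrier n (shift2 n)" and n: "4 \<le> n"
  obtains Y where "Y \<in> Sol_carrier n (shift2 n)" "X * Y = 1\<^sub>m n" "Y * X = 1\<^sub>m n"
proof -
  let ?B = "shift2 n"
  have c: "X \<in> carrier_mat n n" and e: "transpose_mat X * ?B * X = ?B"
    using X by (simp_all add: Sol_carrier_def)
  note e' = Sol_carrier_transpose[OF X shift2_carrier]
  have "det X \<noteq> 0"
  proof
    assume "det X = 0"
    then obtain v where v: "v \<in> carrier_vec n" "v \<noteq> 0\<^sub>v n" "X *\<^sub>v v = 0\<^sub>v n"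
      using det_0_iff_vec_prod_zero_field[OF c] by blast
    \<comment> \<open>Every column of \<open>V\<close> is \<open>v\<close>, so that the entry
      formulas for matrix products apply to the vector.\<close>
    define V where "V = mat n n (\<lambda>(i, j). v $ i)"
    have V: "V \<in> carrier_mat n n" by (simp add: V_def)
    have XV: "X * V = 0\<^sub>m n n"
    proof (rule eq_matI)
      fix i j assume "i < dim_row (0\<^sub>m n n)" "j < dim_col (0\<^sub>m n n)"
      then have ij: "i < n" "j < n" by simp_all
      have "col V j = v" using ij v(1) by (auto simp: V_def)
      then have "(X * V) $$ (i, j) = (X *\<^sub>v v) $ i" using ij c V by simp
      then show "(X * V) $$ (i, j) = 0\<^sub>m n n $$ (i, j)" using ij v(3) by simp
    qed (use c V in simp_all)
    have "?B * V = transpose_mat X * ?B * (X * V)"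
      "transpose_mat ?B * V = transpose_mat X * transpose_mat ?B * (X * V)"
      using arg_cong[OF e, of "\<lambda>M. M * V"] arg_cong[OF e', of "\<lambda>M. M * V"] c V
      by (simp_all add: assoc_mult_mat[of _ n n _ n _ n] mult_carrier_mat[of _ n n _ n])
    then have z: "?B * V = 0\<^sub>m n n" "transpose_mat ?B * V = 0\<^sub>m n n"
      using c by (simp_all add: XV)
    have "v $ i = 0" if i: "i < n" for i
    proof (cases "i < 2")
      case True
      then show ?thesis
        using arg_cong[OF z(2), of "\<lambda>M. M $$ (i + 2, 0)"]
          transpose_shift2_mult_index[OF V, of "i + 2" 0] n by (simp add: V_def)
    next
      case False
      then have "V $$ (i, 0) = 0"
        using arg_cong[OF z(1), of "\<lambda>M. M $$ (i - 2, 0)"]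
          shift2_mult_index[OF V, of "i - 2" 0] le_add_diff_inverse2[of 2 i] n i
        by (simp del: index_mult_mat(1))
      then show ?thesis using i by (simp add: V_def)
    qed
    then show False using v(1,2) by (auto intro: eq_vecI)
  qed
  then have "X \<in> Units (ring_mat TYPE(complex) n n)"
    by (rule det_non_zero_imp_unit[OF c])
  then obtain Y where Y: "Y \<in> carrier_mat n n" "X * Y = 1\<^sub>m n" "Y * X = 1\<^sub>m n"
    unfolding Units_def ring_mat_simps by blast
  have "transpose_mat Y * transpose_mat X = 1\<^sub>m n"
    using arg_cong[OF Y(2), of transpose_mat] c Y(1) by (simp add: transpose_mult[of _ n n _ n])
  moreover have "transpose_mat Y * (transpose_mat X * ?B * X) * Y
      = (transpose_mat Y * transpose_mat X) * ?B * (X * Y)"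
    using c Y(1)
    by (simp add: assoc_mult_mat[of _ n n _ n _ n] mult_carrier_mat[of _ n n _ n])
  ultimately have "transpose_mat Y * ?B * Y = ?B"
    unfolding e Y(2) by simp
  then have "Y \<in> Sol_carrier n ?B" using Y(1) by (simp add: Sol_carrier_def)
  then show ?thesis using Y(2,3) that by blast
qed

lemma Sol_group:
  assumes "4 \<le> n"
  shows "group (Sol n (shift2 n))"
proof (rule groupI)
  fix X assume "X \<in> carrier (Sol n (shift2 n))"
  then show "\<exists>Y\<in>carrier (Sol n (shift2 n)). Y \<otimes>\<^bsub>Sol n (shift2 n)\<^esub> X = \<one>\<^bsub>Sol n (shift2 n)\<^esub>"
    using Sol_carrier_inverse[OF _ assms, of X] by (auto simp: Sol_def)
qed (auto simp: Sol_def intro: Sol_carrier_mult, auto simp: Sol_carrier_def)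

text \<open>The subspace \<open>V\<close> is spanned by the kernels of the pencil \<open>B - \<lambda> B\<^sup>t\<close>, hence invariant. In coordinates:
  \<open>B g = G B\<close> and \<open>B\<^sup>t g = G B\<^sup>t\<close> with \<open>G\<close> the inverse transpose of \<open>g\<close>, and eliminating \<open>G\<close>
  makes \<open>g\<close> constant along diagonals in steps of 4, with zero boundary values.\<close>

lemma Sol_carrier_block_triangular:
  assumes g: "g \<in> Sol_carrier n (shift2 n)" and n: "4 \<le> n"
    and ij: "i < n" "j < n" "2 \<le> i mod 4" "j mod 4 < 2"
  shows "g $$ (i, j) = 0"
proof -
  let ?B = "shift2 n"
  obtain h where h: "h \<in> Sol_carrier n ?B" "g * h = 1\<^sub>m n" "h * g = 1\<^sub>m n"
    using Sol_carrier_inverse[OF g n] by blast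
  define G where "G = transpose_mat h"
  have c: "g \<in> carrier_mat n n" "h \<in> carrier_mat n n" "G \<in> carrier_mat n n"
    using g h(1) by (simp_all add: Sol_carrier_def G_def)
  have Gg: "G * transpose_mat g = 1\<^sub>m n"
    using arg_cong[OF h(2), of transpose_mat] c by (simp add: G_def transpose_mult[of _ n n _ n])
  have "C * g = G * C" if C: "C \<in> carrier_mat n n" "transpose_mat g * C * g = C" for C
  proof -
    have "G * C = (G * transpose_mat g) * C * g"
      using arg_cong[OF C(2), of "\<lambda>M. G * M"] c C(1)
      by (simp add: assoc_mult_mat[of _ n n _ n _ n])
    then show ?thesis using Gg C(1) by simp
  qed
  then have "?B * g = G * ?B" "transpose_mat ?B * g = G * transpose_mat ?B"
    using g Sol_carrier_transpose[OF g] by (simp_all add: Sol_carrier_def)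
  then have up: "(if i + 2 < n then g $$ (i + 2, j) else 0) = (if 2 \<le> j then G $$ (i, j - 2) else 0)"
    and down: "(if 2 \<le> i then g $$ (i - 2, j) else 0) = (if j + 2 < n then G $$ (i, j + 2) else 0)"
    if "i < n" "j < n" for i j
    using shift2_mult_index[OF c(1) that] mult_shift2_index[OF c(3) that]
      transpose_shift2_mult_index[OF c(1) that] mult_transpose_shift2_index[OF c(3) that]
    by simp_all
  \<comment> \<open>In columns 0 and 1 the right side of \<open>up\<close> is 0.\<close>
  have first_cols: "g $$ (i, j) = 0" if "2 \<le> i" "i < n" "j < 2" for i j
    using up[of "i - 2" j] le_add_diff_inverse2[OF that(1)] that by simp
  \<comment> \<open>Both sides equal \<open>G $$ (i + 2, j + 2)\<close>, the left by
    \<open>up\<close> and the right by \<open>down\<close>.\<close>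
  have step: "g $$ (i + 4, j + 4) = g $$ (i, j)" if "i + 4 < n" "j + 4 < n" for i j
    using up[of "i + 2" "j + 4"] down[of "i + 2" j] that by (simp add: numeral_eq_Suc)
  \<comment> \<open>Here \<open>up\<close> gives \<open>G $$ (i - 2, j - 2)\<close>, and
    \<open>down\<close> makes that entry 0 because \<open>i - 2 < 2\<close>.\<close>
  have row: "g $$ (i, j) = 0" if "2 \<le> i" "i < 4" "i < n" "4 \<le> j" "j < n" for i j
  proof -
    have e: "j - 4 + 2 = j - 2" and "j - 2 < n" using that by simp_all
    then show ?thesis
      using up[of "i - 2" j] down[of "i - 2" "j - 4", unfolded e] le_add_diff_inverse2[OF that(1)] that
      by simp
  qed
  show ?thesis
    using ij
  \<comment> \<open>Going back by 4 along the diagonal keeps both residues and ends in columns 0, 1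
    or in rows 2, 3.\<close>
  proof (induction i arbitrary: j rule: less_induct)
    case (less i)
    have "i \<ge> 2" using less.prems by (cases "i < 2") auto
    consider "j < 4" | "i < 4" "4 \<le> j" | "4 \<le> i" "4 \<le> j" by linarith
    then show ?case
    proof cases
      case 1
      then have "j < 2" using less.prems by simp
      then show ?thesis using first_cols \<open>i \<ge> 2\<close> less.prems by blast
    next
      case 2
      then show ?thesis using row \<open>i \<ge> 2\<close> less.prems by blast
    next
      case 3
      have "g $$ (i - 4, j - 4) = 0"
        using 3 less.prems by (intro less.IH) (auto simp: le_mod_geq)
      then show ?thesis using step[of "i - 4" "j - 4"] 3 less.prems by simp
    qed
  qed
qed


subsection \<open>Normality\<close>

text \<open>Block triangularity of \<open>g\<close> and \<open>h\<close> preserves the support. For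
  the Lie algebra equation, moving \<open>g\<close> across the form turns it into the inverse
  \<open>h\<close>, so the left side for \<open>g * X * h\<close> is the one for \<open>X\<close>
  between \<open>transpose_mat h\<close> and \<open>h\<close>.\<close>

lemma ideal_a_conjugate:
  assumes n: "n mod 4 = 2" "4 \<le> n" and X: "X \<in> ideal_a n"
    and g: "g \<in> Sol_carrier n (shift2 n)" and h: "h \<in> Sol_carrier n (shift2 n)"
    and inv: "g * h = 1\<^sub>m n" "h * g = 1\<^sub>m n"
  shows "g * X * h \<in> ideal_a n"
proof -
  let ?B = "shift2 n"
  have c: "g \<in> carrier_mat n n" "h \<in> carrier_mat n n" "X \<in> carrier_mat n n"
    using g h X by (simp_all add: Sol_carrier_def ideal_a_def)
  note tri = Sol_carrier_block_triangular[OF _ n(2)]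
  have X0: "X $$ (i, j) = 0" if "i < n" "j < n" "2 \<le> i mod 4 \<or> j mod 4 < 2" for i j
    using X that unfolding ideal_a_entries[OF n(1)] by blast
  \<comment> \<open>If \<open>2 \<le> i mod 4\<close>, the factor from \<open>g\<close> vanishes for
    \<open>k mod 4 < 2\<close> and the one from \<open>X\<close> for all other \<open>k\<close>; if
    \<open>j mod 4 < 2\<close>, the column of \<open>X\<close> is zero.\<close>
  have gX: "(g * X) $$ (i, j) = 0" if ij: "i < n" "j < n" "2 \<le> i mod 4 \<or> j mod 4 < 2" for i j
  proof -
    have "g $$ (i, k) * X $$ (k, j) = 0" if "k < n" for k
      using X0[of k j] tri[OF g, of i k] ij that by fastforce
    then show ?thesis
      using ij c by (subst mat_mult_entry[of _ n]) (auto intro!: sum.neutral)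
  qed
  have supp: "(g * X * h) $$ (i, j) = 0"
    if ij: "i < n" "j < n" "2 \<le> i mod 4 \<or> j mod 4 < 2" for i j
  proof -
    have "(g * X) $$ (i, k) * h $$ (k, j) = 0" if "k < n" for k
      using gX[of i k] tri[OF h, of k j] ij that by fastforce
    then show ?thesis
      using ij c by (subst mat_mult_entry[of _ n]) (auto intro!: sum.neutral)
  qed
  have e: "transpose_mat g * ?B * g = ?B" "transpose_mat h * ?B * h = ?B"
    using g h by (simp_all add: Sol_carrier_def)
  have "transpose_mat h * transpose_mat g = 1\<^sub>m n"
    using arg_cong[OF inv(1), of transpose_mat] c by (simp add: transpose_mult[of _ n n _ n])
  then have "?B * g = transpose_mat h * ?B"
    using arg_cong[OF e(1), of "\<lambda>M. transpose_mat h * M"] c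
    by (simp add: assoc_mult_mat[of _ n n _ n _ n, symmetric])
  moreover have "transpose_mat g * transpose_mat h = 1\<^sub>m n"
    using arg_cong[OF inv(2), of transpose_mat] c by (simp add: transpose_mult[of _ n n _ n])
  then have "transpose_mat g * ?B = ?B * h"
    using arg_cong[OF e(2), of "\<lambda>M. transpose_mat g * M"] c
    by (simp add: assoc_mult_mat[of _ n n _ n _ n, symmetric])
  moreover have "transpose_mat (g * X * h) * ?B
      = transpose_mat h * (transpose_mat X * (transpose_mat g * ?B))"
    "?B * (g * X * h) = (?B * g) * (X * h)"
    using c by (simp_all add: transpose_mult[of _ n n _ n] assoc_mult_mat[of _ n n _ n _ n]
        mult_carrier_mat[of _ n n _ n])
  ultimately have "transpose_mat (g * X * h) * ?B + ?B * (g * X * h)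
      = transpose_mat h * (transpose_mat X * ?B) * h + transpose_mat h * (?B * X) * h"
    using c by (simp add: assoc_mult_mat[of _ n n _ n _ n] mult_carrier_mat[of _ n n _ n])
  also have "\<dots> = transpose_mat h * (transpose_mat X * ?B + ?B * X) * h"
    using c by (simp add: mult_add_distrib_mat[of _ n n _ n] add_mult_distrib_mat[of _ n n _ _ n]
        mult_carrier_mat[of _ n n _ n])
  also have "transpose_mat X * ?B + ?B * X = 0\<^sub>m n n"
    using X unfolding ideal_a_lie[OF n(1)] by blast
  finally have "transpose_mat (g * X * h) * ?B + ?B * (g * X * h) = 0\<^sub>m n n"
    using c by simp
  then show ?thesis
    using c supp unfolding ideal_a_lie[OF n(1)] by (auto simp del: index_mult_mat(1))
qed

text \<open>Expanding the isometry condition, the linear part is the Lie algebra equation and the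
  quadratic part is the vanishing sandwich.\<close>

lemma shifted_a_subset_Sol_carrier:
  assumes n: "n mod 4 = 2"
  shows "shifted_a n (1\<^sub>m n) \<subseteq> Sol_carrier n (shift2 n)"
proof
  let ?B = "shift2 n"
  fix Y assume "Y \<in> shifted_a n (1\<^sub>m n)"
  then obtain X where X: "X \<in> ideal_a n" and Y: "Y = 1\<^sub>m n + X" by (auto simp: shifted_a_def)
  have c: "X \<in> carrier_mat n n" using X by (simp add: ideal_a_def)
  have lie: "transpose_mat X * ?B + ?B * X = 0\<^sub>m n n"
    using X unfolding ideal_a_lie[OF n] by blast
  have "transpose_mat Y * ?B * Y = (?B + transpose_mat X * ?B) * (1\<^sub>m n + X)"
    using c unfolding Y by (simp add: transpose_add[of _ n n] add_mult_distrib_mat[of _ n n _ _ n])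
  also have "\<dots> = (?B + transpose_mat X * ?B) + (?B * X + transpose_mat X * ?B * X)"
    using c by (simp add: mult_add_distrib_mat[of _ n n _ n] add_mult_distrib_mat[of _ n n _ _ n]
        mult_carrier_mat[of _ n n _ n])
  also have "\<dots> = ?B + (transpose_mat X * ?B + ?B * X)"
    using c unfolding ideal_a_sandwich_eq_0[OF n X]
    by (simp add: assoc_add_mat[of _ n n] mult_carrier_mat[of _ n n _ n])
  also have "\<dots> = ?B"
    unfolding lie by simp
  finally show "Y \<in> Sol_carrier n ?B" using c by (simp add: Y Sol_carrier_def)
qed

text \<open>The cross term \<open>X * Y\<close> vanishes, so the group is a copy of the additive
  group of the ideal; in particular \<open>1\<^sub>m n + - X\<close> is the inverse of
  \<open>1\<^sub>m n + X\<close>.\<close>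

lemma one_plus_ideal_a_mult:
  assumes n: "n mod 4 = 2" and X: "X \<in> ideal_a n" and Y: "Y \<in> ideal_a n"
  shows "(1\<^sub>m n + X) * (1\<^sub>m n + Y) = 1\<^sub>m n + (X + Y)"
proof -
  have c: "X \<in> carrier_mat n n" "Y \<in> carrier_mat n n"
    using X Y by (simp_all add: ideal_a_def)
  have "(1\<^sub>m n + X) * (1\<^sub>m n + Y) = (1\<^sub>m n + X) + (Y + X * Y)"
    using c by (simp add: add_mult_distrib_mat[of _ n n _ _ n] mult_add_distrib_mat[of _ n n _ n])
  then show ?thesis
    using c by (simp add: ideal_a_mult_eq_0[OF n X Y] assoc_add_mat[of _ n n])
qed

lemma shifted_a_normal:
  assumes n: "n mod 4 = 2" "4 \<le> n"
  shows "shifted_a n (1\<^sub>m n) \<lhd> Sol n (shift2 n)"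
proof -
  interpret group "Sol n (shift2 n)" by (rule Sol_group[OF n(2)])
  have neg: "- X \<in> ideal_a n" if X: "X \<in> ideal_a n" for X
  proof -
    have "- X = (-1) \<cdot>\<^sub>m X" by auto
    then show ?thesis using ideal_a_smult[OF n(1) X] by simp
  qed
  have inv: "inv\<^bsub>Sol n (shift2 n)\<^esub> (1\<^sub>m n + X) = 1\<^sub>m n + - X" if X: "X \<in> ideal_a n" for X
  proof (rule inv_equality)
    have "- X + X = 0\<^sub>m n n"
      using ideal_a_carrier[OF X] by auto
    then show "(1\<^sub>m n + - X) \<otimes>\<^bsub>Sol n (shift2 n)\<^esub> (1\<^sub>m n + X) = \<one>\<^bsub>Sol n (shift2 n)\<^esub>"
      "1\<^sub>m n + X \<in> carrier (Sol n (shift2 n))" "1\<^sub>m n + - X \<in> carrier (Sol n (shift2 n))"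
      using X neg[OF X] shifted_a_subset_Sol_carrier[OF n(1)]
      by (auto simp: Sol_def shifted_a_def one_plus_ideal_a_mult[OF n(1)])
  qed
  have "subgroup (shifted_a n (1\<^sub>m n)) (Sol n (shift2 n))"
  proof (rule subgroupI)
    show "shifted_a n (1\<^sub>m n) \<subseteq> carrier (Sol n (shift2 n))"
      using shifted_a_subset_Sol_carrier[OF n(1)] by (simp add: Sol_def)
    show "shifted_a n (1\<^sub>m n) \<noteq> {}"
      using ideal_a_zero[OF n(1)] by (auto simp: shifted_a_def)
    show "inv\<^bsub>Sol n (shift2 n)\<^esub> Y \<in> shifted_a n (1\<^sub>m n)" if "Y \<in> shifted_a n (1\<^sub>m n)" for Y
      using that neg inv by (auto simp: shifted_a_def)
    show "Y \<otimes>\<^bsub>Sol n (shift2 n)\<^esub> Z \<in> shifted_a n (1\<^sub>m n)"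
      if "Y \<in> shifted_a n (1\<^sub>m n)" "Z \<in> shifted_a n (1\<^sub>m n)" for Y Z
      using that one_plus_ideal_a_mult[OF n(1)] ideal_a_add[OF n(1)]
      by (fastforce simp: shifted_a_def Sol_def)
  qed
  moreover have "g \<otimes>\<^bsub>Sol n (shift2 n)\<^esub> Y \<otimes>\<^bsub>Sol n (shift2 n)\<^esub> inv\<^bsub>Sol n (shift2 n)\<^esub> g \<in> shifted_a n (1\<^sub>m n)"
    if g: "g \<in> carrier (Sol n (shift2 n))" and Y: "Y \<in> shifted_a n (1\<^sub>m n)" for g Y
  proof -
    define h where "h = inv\<^bsub>Sol n (shift2 n)\<^esub> g"
    obtain X where X: "X \<in> ideal_a n" and Y: "Y = 1\<^sub>m n + X"
      using Y by (auto simp: shifted_a_def)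
    have gh: "g \<in> Sol_carrier n (shift2 n)" "h \<in> Sol_carrier n (shift2 n)"
      "g * h = 1\<^sub>m n" "h * g = 1\<^sub>m n"
      using g inv_closed[OF g] r_inv[OF g] l_inv[OF g] unfolding h_def by (simp_all add: Sol_def)
    have c: "g \<in> carrier_mat n n" "h \<in> carrier_mat n n" "X \<in> carrier_mat n n"
      using gh X by (simp_all add: Sol_carrier_def ideal_a_def)
    \<comment> \<open>Conjugation fixes the identity summand, which reduces normality to invariance
      of the ideal.\<close>
    have "g * Y * h = 1\<^sub>m n + g * X * h"
      using c gh(3) unfolding Y
      by (simp add: mult_add_distrib_mat[of _ n n _ n] add_mult_distrib_mat[of _ n n _ _ n])
    then show ?thesis
      using ideal_a_conjugate[OF n X gh] unfolding h_def[symmetric] shifted_a_def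
      by (auto simp: Sol_def)
  qed
  ultimately show ?thesis
    unfolding normal_inv_iff by blast
qed

subsection \<open>The Lie algebra\<close>

lemma pow_mat_entry_bound:
  fixes X :: "complex mat"
  assumes X: "X \<in> carrier_mat n n" and M: "\<And>i j. i < n \<Longrightarrow> j < n \<Longrightarrow> cmod (X $$ (i, j)) \<le> M"
    and ij: "i < n" "j < n"
  shows "cmod ((X ^\<^sub>m k) $$ (i, j)) \<le> (real n * M) ^ k"
  using ij
proof (induction k arbitrary: i j)
  case 0
  then show ?case using X by simp
next
  case (Suc k)
  have "(X ^\<^sub>m Suc k) $$ (i, j) = (\<Sum>l = 0..<n. (X ^\<^sub>m k) $$ (i, l) * X $$ (l, j))"
    using Suc.prems X pow_carrier_mat[OF X, of k] by (simp add: scalar_prod_def)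
  also have "cmod \<dots> \<le> (\<Sum>l = 0..<n. (real n * M) ^ k * M)"
    \<comment> \<open>The bound on the entry \<open>(i, j)\<close> shows that \<open>M\<close> is
      nonnegative, as monotonicity of products requires.\<close>
    using Suc M order_trans[OF norm_ge_zero M[OF Suc.prems]]
    by (intro sum_norm_le) (auto simp: norm_mult intro!: mult_mono)
  also have "\<dots> = (real n * M) ^ Suc k" by simp
  finally show ?case .
qed

lemma smult_pow_mat:
  fixes X :: "complex mat"
  assumes X: "X \<in> carrier_mat n n"
  shows "(c \<cdot>\<^sub>m X) ^\<^sub>m k = c ^ k \<cdot>\<^sub>m X ^\<^sub>m k"
proof (induction k)
  case 0
  then show ?case using X by auto
next
  case (Suc k)
  have "c \<cdot>\<^sub>m (d \<cdot>\<^sub>m M) = (c * d) \<cdot>\<^sub>m M" for d and M :: "complex mat"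
    by (rule eq_matI) auto
  then show ?case
    using Suc X pow_carrier_mat[OF X, of k] by (simp add: mult_smult_assoc_mat[of _ n n _ n]
        mult_smult_distrib[of _ n n _ n])
qed

text \<open>As a power series in \<open>z\<close>, an entry of the exponential can be differentiated
  term by term.\<close>

lemma mat_exp_smult_index:
  assumes "X \<in> carrier_mat n n" "i < n" "j < n"
  shows "mat_exp n (z \<cdot>\<^sub>m X) $$ (i, j) = (\<Sum>k. (X ^\<^sub>m k) $$ (i, j) / fact k * z ^ k)"
  using assms pow_carrier_mat[OF assms(1)]
  by (simp add: mat_exp_def smult_pow_mat mult.commute)

lemma mat_exp_series_summable:
  fixes X :: "complex mat"
  assumes X: "X \<in> carrier_mat n n" and ij: "i < n" "j < n"
  shows "summable (\<lambda>k. (X ^\<^sub>m k) $$ (i, j) / fact k * z ^ k)"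
proof (rule summable_comparison_test')
  \<comment> \<open>The sum of all absolute values is a crude common bound for the entries; the
    majorant is then a scalar exponential series.\<close>
  define M where "M = (\<Sum>i<n. \<Sum>j<n. cmod (X $$ (i, j)))"
  have M: "cmod (X $$ (i, j)) \<le> M" if "i < n" "j < n" for i j
  proof -
    have "cmod (X $$ (i, j)) \<le> (\<Sum>j<n. cmod (X $$ (i, j)))"
      using that by (intro member_le_sum) auto
    also have "\<dots> \<le> M"
      unfolding M_def using that by (intro member_le_sum) (auto intro: sum_nonneg)
    finally show ?thesis .
  qed
  show "summable (\<lambda>k. inverse (fact k) * (real n * M * cmod z) ^ k)"
    by (rule summable_exp)
  show "norm ((X ^\<^sub>m k) $$ (i, j) / fact k * z ^ k) \<le> inverse (fact k) * (real n * M * cmod z) ^ k" for k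
  proof -
    have "norm ((X ^\<^sub>m k) $$ (i, j) / fact k * z ^ k)
        = inverse (fact k) * (cmod ((X ^\<^sub>m k) $$ (i, j)) * cmod z ^ k)"
      by (simp add: norm_mult norm_divide norm_power norm_inverse norm_fact divide_inverse mult_ac)
    also have "\<dots> \<le> inverse (fact k) * ((real n * M) ^ k * cmod z ^ k)"
      using pow_mat_entry_bound[OF X M ij] by (intro mult_left_mono mult_right_mono) auto
    finally show ?thesis by (simp add: power_mult_distrib)
  qed
qed

lemma mat_exp_square_zero:
  assumes X: "X \<in> carrier_mat n n" and XX: "X * X = 0\<^sub>m n n"
  shows "mat_exp n X = 1\<^sub>m n + X"
proof (rule eq_matI)
  fix i j assume "i < dim_row (1\<^sub>m n + X)" "j < dim_col (1\<^sub>m n + X)"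
  then have ij: "i < n" "j < n" using X by simp_all
  have "X ^\<^sub>m (k + 2) = 0\<^sub>m n n" for k
  proof -
    have "X ^\<^sub>m (k + 2) = X ^\<^sub>m k * (X * X)"
      using X pow_carrier_mat[OF X, of k] by (simp add: assoc_mult_mat[of _ n n _ n _ n])
    then show ?thesis
      using pow_carrier_mat[OF X, of k] by (simp add: XX right_mult_zero_mat[of _ n n])
  qed
  then have "(X ^\<^sub>m k) $$ (i, j) = 0" if "2 \<le> k" for k
    using ij le_add_diff_inverse2[OF that] by (metis index_zero_mat(1))
  then have "(\<Sum>k. (X ^\<^sub>m k) $$ (i, j) / fact k) = (\<Sum>k\<in>{0, 1}. (X ^\<^sub>m k) $$ (i, j) / fact k)"
    by (intro suminf_finite) auto
  also have "\<dots> = (1\<^sub>m n + X) $$ (i, j)"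
    using X ij by simp
  finally show "mat_exp n X $$ (i, j) = (1\<^sub>m n + X) $$ (i, j)"
    using ij by (simp add: mat_exp_def)
qed (use X in \<open>simp_all add: mat_exp_def\<close>)

lemma mat_exp_difference_quotient:
  assumes X: "X \<in> carrier_mat n n" and ij: "i < n" "j < n"
  shows "(\<lambda>k. (mat_exp n (complex_of_real (inverse (Suc k)) \<cdot>\<^sub>m X) $$ (i, j) - 1\<^sub>m n $$ (i, j)) *
    of_nat (Suc k)) \<longlonglongrightarrow> X $$ (i, j)"
proof -
  define c where "c k = (X ^\<^sub>m k) $$ (i, j) / fact k" for k
  define f where "f z = mat_exp n (z \<cdot>\<^sub>m X) $$ (i, j)" for z
  have f: "f = (\<lambda>z. \<Sum>k. c k * z ^ k)"
    using mat_exp_smult_index[OF X ij] by (auto simp: f_def c_def)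
  have "(f has_field_derivative (\<Sum>k. diffs c k * 0 ^ k)) (at 0)"
    unfolding f c_def by (rule termdiffs_strong_converges_everywhere[OF mat_exp_series_summable[OF X ij]])
  \<comment> \<open>Only \<open>diffs c 0\<close> survives at 0; it is the degree 1 coefficient
    \<open>c 1\<close>.\<close>
  moreover have "(\<Sum>k. diffs c k * 0 ^ k) = X $$ (i, j)"
    unfolding powser_zero using X by (simp add: diffs_def c_def)
  ultimately have "(f has_field_derivative X $$ (i, j)) (at 0)" by simp
  from DERIV_D[OF this] have lim: "(\<lambda>h. (f h - f 0) / h) \<midarrow>0\<rightarrow> X $$ (i, j)" by simp
  have "f 0 = c 0"
    unfolding f by (rule powser_zero)
  then have f0: "f 0 = 1\<^sub>m n $$ (i, j)"
    using X by (simp add: c_def)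
  \<comment> \<open>The reciprocals tend to 0 without being 0, as the punctured limit
    requires.\<close>
  have "filterlim (\<lambda>k. complex_of_real (inverse (Suc k))) (at 0) sequentially"
    using tendsto_of_real[OF LIMSEQ_inverse_real_of_nat, where 'a = complex]
    by (intro filterlim_atI) (auto simp del: of_nat_Suc)
  from filterlim_compose[OF lim this]
  have "(\<lambda>k. (f (complex_of_real (inverse (Suc k))) - 1\<^sub>m n $$ (i, j)) /
      complex_of_real (inverse (Suc k))) \<longlonglongrightarrow> X $$ (i, j)"
    unfolding f0 .
  then show ?thesis
    by (simp add: f_def field_simps)
qed

lemma Lie_algebra_of_shifted_a:
  assumes n: "n mod 4 = 2"
  shows "Lie_algebra_of n (shifted_a n (1\<^sub>m n)) = ideal_a n"
proof (intro equalityI subsetI)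
  fix X assume X: "X \<in> ideal_a n"
  then have c: "X \<in> carrier_mat n n" by (simp add: ideal_a_def)
  \<comment> \<open>The multiple \<open>t \<cdot>\<^sub>m X\<close> is again in the ideal, so its
    square vanishes.\<close>
  have "mat_exp n (t \<cdot>\<^sub>m X) = 1\<^sub>m n + t \<cdot>\<^sub>m X" for t
    using ideal_a_mult_eq_0[OF n] ideal_a_smult[OF n X] c by (intro mat_exp_square_zero) auto
  then show "X \<in> Lie_algebra_of n (shifted_a n (1\<^sub>m n))"
    using c ideal_a_smult[OF n X] by (auto simp: Lie_algebra_of_def shifted_a_def)
next
  fix X assume "X \<in> Lie_algebra_of n (shifted_a n (1\<^sub>m n))"
  then have c: "X \<in> carrier_mat n n"
    and "\<And>t :: real. \<exists>Y. mat_exp n (complex_of_real t \<cdot>\<^sub>m X) = 1\<^sub>m n + Y \<and> Y \<in> ideal_a n"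
    unfolding Lie_algebra_of_def shifted_a_def by blast+
  then obtain Y where Y: "\<And>t :: real. mat_exp n (complex_of_real t \<cdot>\<^sub>m X) = 1\<^sub>m n + Y t"
    "\<And>t. Y t \<in> ideal_a n" by metis
  show "X \<in> ideal_a n"
  proof (rule ideal_a_entrywise_limit[OF n c])
    \<comment> \<open>These are the difference quotients of the one-parameter group at 0 along
      \<open>t = inverse (Suc k)\<close>; their limit is \<open>X\<close>.\<close>
    show "of_nat (Suc k) \<cdot>\<^sub>m Y (inverse (Suc k)) \<in> ideal_a n" for k
      by (rule ideal_a_smult[OF n Y(2)])
    fix i j assume ij: "i < n" "j < n"
    have "dim_row (Y t) = n" "dim_col (Y t) = n" for t
      using ideal_a_carrier[OF Y(2)] by blast+
    then show "(\<lambda>k. (of_nat (Suc k) \<cdot>\<^sub>m Y (inverse (Suc k))) $$ (i, j)) \<longlonglongrightarrow> X $$ (i, j)"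
      using mat_exp_difference_quotient[OF c ij] ij unfolding Y(1) by (simp add: mult.commute)
  qed
qed

text \<open>Since all products vanish, every bracket is the zero matrix.\<close>

lemma ideal_a_lie_algebra:
  assumes n: "n mod 4 = 2"
  shows "matrix_lie_algebra n (ideal_a n)"
  unfolding matrix_lie_algebra_def lie_bracket_def
  using ideal_a_mult_eq_0[OF n] ideal_a_zero[OF n] ideal_a_add[OF n] ideal_a_smult[OF n]
  by (auto dest: ideal_a_carrier simp: minus_r_inv_mat[OF zero_carrier_mat[of n n]])

theorem proposition5p20:
  fixes n :: nat
  assumes "n mod 4 = 2" and "n \<ge> 6"
  shows "shifted_a n (1\<^sub>m n) \<lhd> Sol n (A_mat n ^\<^sub>m 2) \<and>
         lie_isomorphic n (Lie_algebra_of n (shifted_a n (1\<^sub>m n))) (ideal_a n)"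
  \<comment> \<open>The Lie algebra of the group equals the ideal as a set, so the identity map is
    the isomorphism.\<close>
  unfolding A_mat_square Lie_algebra_of_shifted_a[OF assms(1)] lie_isomorphic_def
  using assms ideal_a_lie_algebra[OF assms(1)]
  by (intro conjI shifted_a_normal exI[of _ "\<lambda>X. X"]) (auto simp: bij_betw_def)

end
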